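(* For every $\beta\in\{\operatorname{tw},\operatorname{la},\operatorname{pw},\operatorname{ppw}\}$ and every fixed integer $r\ge 3$, $\underline{\beta}(r;n)=\Theta(n)$ as $n\to\infty$. Specifically, as $n\to\infty$, \[\frac12-o(1)< r-\sqrt{r^2-r}-o(1)\le \frac{\underline{\beta}(r;n)}{n}\le \frac34+o(1).\]
   Context: All graphs are finite, simple and undirected. An $r$-decomposition of the complete graph $K_n=([n],E)$ is a partition of $E$ into edge sets $E_1,\dots,E_r$ (possibly empty) of spanning subgraphs $G_i=([n],E_i)$. For a nonnegative integer valued graph parameter $\beta$, $\underline{\beta}(r;n):=\min\{\beta(G_1)+\dots+\beta(G_r)\}$, the minimum over all $r$-decompositions $G_1,\dots,G_r$ of $K_n$. Tree-width and variants. For a graph with no edges, $\operatorname{tw},\operatorname{la},\operatorname{pw},\operatorname{ppw}$ are all $0$. For $G$ with an edge and positive integers $k$: a $k$-tree is built by starting with $K_{k+1}$ and repeatedly adding a new vertex joined to all vertices of an existing $k$-clique. A facet of a maximal clique (order $k+1$) of a $k$-tree is one of its $k$-clique subgraphs. A linear $k$-tree starts with $K_{k+1}$ and each new vertex is joined to a facet that includes the vertex added in the previous step. A $k$-caterpillar starts with $K_{k+1}$ and each new vertex is joined to the $k$ vertices of some facet of the maximal clique added in the previous step. A two-sided $k$-tree starts with $K_{k+1}$ and each new vertex is joined to the vertices of an existing $K_k$ that either includes a vertex of degree $k$ or is the same $K_k$ to which some previous vertex was connected. Then the tree-width $\operatorname{tw}(G)$, largeur d'arborescence $\operatorname{la}(G)$,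 path-width $\operatorname{pw}(G)$, proper path-width $\operatorname{ppw}(G)$ is the minimum $k$ such that $G$ is a subgraph of a $k$-tree, two-sided $k$-tree, $k$-caterpillar, linear $k$-tree, respectively. Here $r$ and $\beta$ are fixed, and $o(1)$ denotes a function of $n$ tending to $0$ as $n\to\infty$; in the first inequality of the display, the two occurrences of $o(1)$ may be taken to be the same function (so that inequality expresses $\frac12<r-\sqrt{r^2-r}$). $f=\Theta(g)$ means there are positive constants $c,C,N$ with $c|g(n)|\le|f(n)|\le C|g(n)|$ for all $n\ge N$. *)

theory Defs
  imports
    Complex_Main
    "HOL-Library.Ramsey"
    "HOL-Library.Disjoint_Sets"
    "HOL-Library.Landau_Symbols"
begin

text \<open>A graph is a pair of a vertex set and an edge set, edges being two-element sets of
  vertices. The vertex type \<^typ>\<open>nat\<close> is infinite, so every finite graph on \<open>{1..n}\<close> that is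
  a subgraph of a member of an isomorphism-closed class up to isomorphism is literally
  contained in a member of that class with vertices in \<^typ>\<open>nat\<close>.\<close>

type_synonym graph = "nat set \<times> nat set set"

definition complete_graph :: "nat set \<Rightarrow> graph" where
  "complete_graph V = (V, nsets V 2)"

definition subgraph :: "graph \<Rightarrow> graph \<Rightarrow> bool" where
  "subgraph G H \<longleftrightarrow> fst G \<subseteq> fst H \<and> snd G \<subseteq> snd H"

definition k_clique :: "nat \<Rightarrow> graph \<Rightarrow> nat set \<Rightarrow> bool" where
  "k_clique k G C \<longleftrightarrow> C \<subseteq> fst G \<and> finite C \<and> card C = k \<and> nsets C 2 \<subseteq> snd G"

definition degree :: "graph \<Rightarrow> nat \<Rightarrow> nat" where
  "degree G v = card {e \<in> snd G. v \<in> e}"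

text \<open>In the definitions below \<open>Q\<close> is always a clique of order \<open>k + 1\<close>, so that its
  \<open>k\<close>-subsets are exactly (the vertex sets of) its \<open>k\<close>-clique subgraphs.\<close>

definition facet :: "nat \<Rightarrow> nat set \<Rightarrow> nat set \<Rightarrow> bool" where
  "facet k Q F \<longleftrightarrow> F \<subseteq> Q \<and> finite F \<and> card F = k"

definition attach :: "nat \<Rightarrow> nat set \<Rightarrow> graph \<Rightarrow> graph" where
  "attach v C G = (insert v (fst G), snd G \<union> {{v, x} | x. x \<in> C})"

inductive k_tree :: "nat \<Rightarrow> graph \<Rightarrow> bool" for k :: nat where
  start: "card V = k + 1 \<Longrightarrow> k_tree k (complete_graph V)"
| step: "\<lbrakk>k_tree k G; v \<notin> fst G; k_clique k G C\<rbrakk> \<Longrightarrow> k_tree k (attach v C G)"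

text \<open>The extra argument is the vertex added in the previous step. The vertices of the initial
  complete graph come in no particular order, so any of them may play this role at the start;
  hence, for \<open>k \<ge> 1\<close>, the first new vertex may be joined to any facet.\<close>

inductive linear_k_tree_last :: "nat \<Rightarrow> graph \<Rightarrow> nat \<Rightarrow> bool" for k :: nat where
  start: "\<lbrakk>card V = k + 1; u \<in> V\<rbrakk> \<Longrightarrow> linear_k_tree_last k (complete_graph V) u"
| step: "\<lbrakk>linear_k_tree_last k G u; v \<notin> fst G; k_clique (k + 1) G Q; facet k Q F; u \<in> F\<rbrakk>
    \<Longrightarrow> linear_k_tree_last k (attach v F G) v"

definition linear_k_tree :: "nat \<Rightarrow> graph \<Rightarrow> bool" where
  "linear_k_tree k G \<longleftrightarrow> (\<exists>u. linear_k_tree_last k G u)"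

text \<open>The extra argument is the maximal clique added in the previous step.\<close>

inductive k_caterpillar_last :: "nat \<Rightarrow> graph \<Rightarrow> nat set \<Rightarrow> bool" for k :: nat where
  start: "card V = k + 1 \<Longrightarrow> k_caterpillar_last k (complete_graph V) V"
| step: "\<lbrakk>k_caterpillar_last k G Q; v \<notin> fst G; facet k Q F\<rbrakk>
    \<Longrightarrow> k_caterpillar_last k (attach v F G) (insert v F)"

definition k_caterpillar :: "nat \<Rightarrow> graph \<Rightarrow> bool" where
  "k_caterpillar k G \<longleftrightarrow> (\<exists>Q. k_caterpillar_last k G Q)"

text \<open>The extra argument collects the cliques to which new vertices have been joined so far.
  Degrees are taken in the graph built so far, before the new vertex is added.\<close>

inductive two_sided_k_tree_used :: "nat \<Rightarrow> graph \<Rightarrow> nat set set \<Rightarrow> bool" for k :: nat where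
  start: "card V = k + 1 \<Longrightarrow> two_sided_k_tree_used k (complete_graph V) {}"
| step: "\<lbrakk>two_sided_k_tree_used k G U; v \<notin> fst G; k_clique k G C;
      (\<exists>u\<in>C. degree G u = k) \<or> C \<in> U\<rbrakk>
    \<Longrightarrow> two_sided_k_tree_used k (attach v C G) (insert C U)"

definition two_sided_k_tree :: "nat \<Rightarrow> graph \<Rightarrow> bool" where
  "two_sided_k_tree k G \<longleftrightarrow> (\<exists>U. two_sided_k_tree_used k G U)"

definition width :: "(nat \<Rightarrow> graph \<Rightarrow> bool) \<Rightarrow> graph \<Rightarrow> nat" where
  "width T G = (if snd G = {} then 0 else (LEAST k. 0 < k \<and> (\<exists>H. T k H \<and> subgraph G H)))"

definition tw :: "graph \<Rightarrow> nat" where "tw = width k_tree"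
definition la :: "graph \<Rightarrow> nat" where "la = width two_sided_k_tree"
definition pw :: "graph \<Rightarrow> nat" where "pw = width k_caterpillar"
definition ppw :: "graph \<Rightarrow> nat" where "ppw = width linear_k_tree"

text \<open>Only the values \<open>E 1, \<dots>, E r\<close> matter; they may be empty.\<close>

definition decomposition :: "nat \<Rightarrow> nat \<Rightarrow> (nat \<Rightarrow> nat set set) \<Rightarrow> bool" where
  "decomposition r n E \<longleftrightarrow>
     (\<Union>i\<in>{1..r}. E i) = nsets {1..n} 2 \<and> disjoint_family_on E {1..r}"

definition min_decomposition_sum :: "(graph \<Rightarrow> nat) \<Rightarrow> nat \<Rightarrow> nat \<Rightarrow> nat" where
  "min_decomposition_sum \<beta> r n =
     (LEAST s. \<exists>E. decomposition r n E \<and> s = (\<Sum>i=1..r. \<beta> ({1..n}, E i)))"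

end

theory Submission
  imports Defs "HOL-Analysis.Convex"
begin

text \<open>
  Every linear \<open>k\<close>-tree is a \<open>k\<close>-caterpillar, a two-sided \<open>k\<close>-tree and a \<open>k\<close>-tree, and every
  member of these classes is a \<open>k\<close>-tree. So one argument treats all four parameters: the lower
  bound only needs to hold for \<open>k\<close>-trees, and the upper bound only needs linear \<open>k\<close>-trees
  (\<open>width_class_between\<close>).

  Lower bound. Each new vertex of a \<open>k\<close>-tree brings \<open>k\<close> edges, so at least \<open>k\<close> vertices \<open>W\<close> of it
  span at most \<open>k * card W - k * (k + 1) / 2\<close> edges (\<open>k_tree_edge_bound\<close>). If the \<open>r\<close> parts of a
  decomposition of \<open>K\<^sub>n\<close> have widths \<open>k\<^sub>1, \<dots>, k\<^sub>r\<close> with sum \<open>s\<close>, counting the edges of \<open>K\<^sub>n\<close> gives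
  \<open>n\<^sup>2 - n \<le> 2 * n * s - (k\<^sub>1\<^sup>2 + \<dots> + k\<^sub>r\<^sup>2)\<close>. The sum of squares is at least \<open>s\<^sup>2 / r\<close>, and completing
  the square yields \<open>(r * n - s)\<^sup>2 \<le> (r\<^sup>2 - r) * n\<^sup>2 + r * n\<close>, that is
  \<open>s / n \<ge> r - sqrt (r\<^sup>2 - r) - sqrt (r / n)\<close> (\<open>decomposition_sum_lower\<close>).

  Upper bound. Cut the vertices into four blocks of about \<open>n / 4\<close> vertices each. The six pairs of
  blocks split into three perfect matchings, and each matching gives one graph: in a matched pair,
  one block, the core, is made a clique and completely joined to the other block. The cores can be
  chosen so that every block is a core at least once; then the three graphs cover \<open>K\<^sub>n\<close>. Each of
  them has proper path-width at most about \<open>n / 4\<close>: keep the core in the current maximal clique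
  while the vertices of the other block pass through it one by one, then replace the clique by the
  core of the second pair and repeat (\<open>linear_k_tree_two_blocks\<close>, \<open>decomposition_sum_upper\<close>).
\<close>

section \<open>Linear k-trees are the smallest class, k-trees the largest\<close>

lemma nsets_two_iff: "e \<in> nsets A 2 \<longleftrightarrow> (\<exists>x y. x \<in> A \<and> y \<in> A \<and> x \<noteq> y \<and> e = {x, y})"
  by (auto simp: nsets_def card_2_iff)

lemma two_times_choose_two: "2 * (n choose 2) = n * (n - 1)"
proof -
  have "even (n * (n - 1))" by (cases n) auto
  then show ?thesis by (simp add: choose_two)
qed

lemma k_clique_facet:
  assumes "k_clique (k + 1) G Q" "facet k Q F"
  shows "k_clique k G F"
proof -
  have "F \<subseteq> Q" "finite F" "card F = k" using assms(2) by (simp_all add: facet_def)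
  with assms(1) show ?thesis
    unfolding k_clique_def using nsets_mono[of F Q 2] by blast
qed

lemma k_clique_attach:
  assumes "k_clique k G F" "v \<notin> F"
  shows "k_clique (k + 1) (attach v F G) (insert v F)"
proof -
  have "nsets (insert v F) 2 \<subseteq> snd G \<union> {{v, x} |x. x \<in> F}"
  proof
    fix e assume "e \<in> nsets (insert v F) 2"
    then obtain x y where e: "e = {x, y}" "x \<noteq> y" "x \<in> insert v F" "y \<in> insert v F"
      unfolding nsets_two_iff by blast
    show "e \<in> snd G \<union> {{v, x} |x. x \<in> F}"
    proof (cases "x \<in> F \<and> y \<in> F")
      case True
      then have "e \<in> nsets F 2" using e nsets_two_iff by blast
      then show ?thesis using assms by (auto simp: k_clique_def)
    next
      case False
      then show ?thesis using e by (auto simp: insert_commute)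
    qed
  qed
  then show ?thesis using assms by (auto simp: k_clique_def attach_def)
qed

lemma linear_k_tree_last_k_tree: "linear_k_tree_last k G u \<Longrightarrow> k_tree k G"
proof (induction rule: linear_k_tree_last.induct)
  case (start V u)
  then show ?case by (auto intro: k_tree.start)
next
  case (step G u v Q F)
  then have "k_clique k G F"
    using k_clique_facet by blast
  with step show ?case by (auto intro: k_tree.step)
qed

lemma k_caterpillar_last_k_tree:
  "k_caterpillar_last k G Q \<Longrightarrow> k_tree k G \<and> k_clique (k + 1) G Q"
proof (induction rule: k_caterpillar_last.induct)
  case (start V)
  moreover from this have "finite V" by (auto intro: card_ge_0_finite)
  ultimately show ?case
    by (simp add: k_tree.start) (simp add: k_clique_def complete_graph_def)
next
  case (step G Q v F)
  then have F: "k_clique k G F" using k_clique_facet by blast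
  moreover have "v \<notin> F" using F step(2) by (auto simp: k_clique_def)
  ultimately have "k_clique (k + 1) (attach v F G) (insert v F)" by (rule k_clique_attach)
  with F step show ?case by (auto intro: k_tree.step)
qed

lemma two_sided_k_tree_used_k_tree: "two_sided_k_tree_used k G U \<Longrightarrow> k_tree k G"
  by (induction rule: two_sided_k_tree_used.induct) (auto intro: k_tree.start k_tree.step)

lemma k_tree_edges:
  "k_tree k G \<Longrightarrow> finite (fst G) \<and> snd G \<subseteq> nsets (fst G) 2"
proof (induction rule: k_tree.induct)
  case (start V)
  then show ?case by (auto simp: complete_graph_def intro: card_ge_0_finite)
next
  case (step G v C)
  then have C: "C \<subseteq> fst G" by (simp add: k_clique_def)
  have "snd (attach v C G) \<subseteq> nsets (insert v (fst G)) 2"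
  proof
    fix e assume "e \<in> snd (attach v C G)"
    then consider "e \<in> snd G" | x where "x \<in> C" "e = {v, x}" by (auto simp: attach_def)
    then show "e \<in> nsets (insert v (fst G)) 2"
    proof cases
      case 1
      then show ?thesis using step.IH nsets_mono[of "fst G" "insert v (fst G)" 2] by blast
    next
      case 2
      then show ?thesis using C step(2) unfolding nsets_two_iff by blast
    qed
  qed
  then show ?case using step.IH by (simp add: attach_def)
qed

text \<open>The last vertex \<open>u\<close> still has degree \<open>k\<close>, so its closed neighbourhood is the
  clique added in the previous step. A facet of any maximal clique through \<open>u\<close> therefore lies in
  that last clique, as a caterpillar demands, and contains a vertex of degree \<open>k\<close>, as a two-sided
  \<open>k\<close>-tree demands.\<close>

lemma linear_k_tree_last_invariant:
  assumes "linear_k_tree_last k G u"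
  shows "\<exists>Q U. k_caterpillar_last k G Q \<and> two_sided_k_tree_used k G U \<and> u \<in> Q \<and>
    degree G u = k \<and> (\<forall>x. {u, x} \<in> snd G \<longrightarrow> x \<in> Q)"
  using assms
proof (induction rule: linear_k_tree_last.induct)
  case (start V u)
  have fin: "finite V" using start by (auto intro: card_ge_0_finite)
  have "{e \<in> nsets V 2. u \<in> e} = (\<lambda>x. {u, x}) ` (V - {u})"
    using start by (auto simp: nsets_two_iff)
  moreover have "inj_on (\<lambda>x. {u, x}) (V - {u})"
    by (auto simp: inj_on_def doubleton_eq_iff)
  ultimately have "degree (complete_graph V) u = k"
    using start fin by (simp add: degree_def complete_graph_def card_image)
  moreover have "\<forall>x. {u, x} \<in> snd (complete_graph V) \<longrightarrow> x \<in> V"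
    by (auto simp: complete_graph_def nsets_def)
  ultimately show ?case
    using start k_caterpillar_last.start two_sided_k_tree_used.start by meson
next
  case (step G u v Q F)
  then obtain Q' U where IH: "k_caterpillar_last k G Q'" "two_sided_k_tree_used k G U"
    "u \<in> Q'" "degree G u = k" "\<And>x. {u, x} \<in> snd G \<Longrightarrow> x \<in> Q'"
    by blast
  have F: "k_clique k G F" "u \<in> F" "finite F" "card F = k"
    using step k_clique_facet[OF step(3,4)] by (simp_all add: facet_def)
  have "F \<subseteq> Q'"
  proof
    fix x assume "x \<in> F"
    then have "x = u \<or> {u, x} \<in> snd G"
      using F unfolding k_clique_def by (metis nsets_two_iff subsetD)
    then show "x \<in> Q'" using IH by auto
  qed
  then have "facet k Q' F" using F by (simp add: facet_def)
  then have cat: "k_caterpillar_last k (attach v F G) (insert v F)"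
    using IH step k_caterpillar_last.step by blast
  have two: "two_sided_k_tree_used k (attach v F G) (insert F U)"
    using IH step F two_sided_k_tree_used.step by blast
  have old: "v \<notin> e" if "e \<in> snd G" for e
    using k_tree_edges[OF linear_k_tree_last_k_tree[OF step(1)]] that step(2)
    by (auto simp: nsets_def)
  have "{e \<in> snd (attach v F G). v \<in> e} = (\<lambda>x. {v, x}) ` F"
    using old by (auto simp: attach_def)
  moreover have "inj_on (\<lambda>x. {v, x}) F"
    by (auto simp: inj_on_def doubleton_eq_iff)
  ultimately have "degree (attach v F G) v = k"
    using F by (simp add: degree_def card_image)
  moreover have "\<forall>x. {v, x} \<in> snd (attach v F G) \<longrightarrow> x \<in> insert v F"
    using old by (auto simp: attach_def doubleton_eq_iff)
  ultimately show ?case using cat two by blast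
qed

text \<open>The only information about the four classes that the two bounds use.\<close>

lemma width_class_between:
  assumes "\<beta> \<in> {tw, la, pw, ppw}"
  obtains T where "\<beta> = width T" "\<And>k H. T k H \<Longrightarrow> k_tree k H" "\<And>k H. linear_k_tree k H \<Longrightarrow> T k H"
proof -
  have lin: "linear_k_tree k H \<Longrightarrow> k_tree k H" for k H
    unfolding linear_k_tree_def using linear_k_tree_last_k_tree by blast
  from assms consider "\<beta> = tw" | "\<beta> = la" | "\<beta> = pw" | "\<beta> = ppw" by blast
  then show ?thesis
  proof cases
    case 1
    then show ?thesis using that[of k_tree] lin by (simp add: tw_def)
  next
    case 2
    have "two_sided_k_tree k H \<Longrightarrow> k_tree k H" for k H
      unfolding two_sided_k_tree_def using two_sided_k_tree_used_k_tree by blast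
    moreover have "linear_k_tree k H \<Longrightarrow> two_sided_k_tree k H" for k H
      unfolding two_sided_k_tree_def linear_k_tree_def
      using linear_k_tree_last_invariant by blast
    ultimately show ?thesis using that[of two_sided_k_tree] 2 by (simp add: la_def)
  next
    case 3
    have "k_caterpillar k H \<Longrightarrow> k_tree k H" for k H
      unfolding k_caterpillar_def using k_caterpillar_last_k_tree by blast
    moreover have "linear_k_tree k H \<Longrightarrow> k_caterpillar k H" for k H
      unfolding k_caterpillar_def linear_k_tree_def
      using linear_k_tree_last_invariant by blast
    ultimately show ?thesis using that[of k_caterpillar] 3 by (simp add: pw_def)
  next
    case 4
    then show ?thesis using that[of linear_k_tree] lin by (simp add: ppw_def)
  qed
qed

section \<open>Counting edges: the lower bound\<close>

text \<open>The bound concerns a subset \<open>W\<close> of the vertices because a graph on \<open>n\<close> vertices may sit inside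
  a \<open>k\<close>-tree with many more. Going back one construction step, \<open>W\<close> loses at most one vertex
  and \<open>k\<close> edges. A set of exactly \<open>k\<close> vertices becomes too small in this way, but it spans at most
  \<open>k choose 2\<close> edges, which is just what the bound allows. For smaller sets the bound may fail, whence \<open>k \<le> card W\<close>.\<close>

lemma k_tree_edge_bound:
  assumes "k_tree k G" "W \<subseteq> fst G" "k \<le> card W"
  shows "2 * card {e \<in> snd G. e \<subseteq> W} + k * (k + 1) \<le> 2 * k * card W"
  using assms
proof (induction arbitrary: W rule: k_tree.induct)
  case (start V)
  have fin: "finite V" using start by (auto intro: card_ge_0_finite)
  then have W: "finite W" "card W \<le> k + 1"
    using start card_mono[of V W] by (auto simp: complete_graph_def finite_subset)
  have "{e \<in> snd (complete_graph V). e \<subseteq> W} = nsets W 2"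
    using start by (auto simp: complete_graph_def nsets_def)
  then have "2 * card {e \<in> snd (complete_graph V). e \<subseteq> W} = card W * (card W - 1)"
    by (metis card_nsets two_times_choose_two)
  moreover have "card W = k \<or> card W = k + 1" using start W by linarith
  ultimately show ?case by (cases k) (auto simp: algebra_simps)
next
  case (step G v C)
  have G: "finite (fst G)" "snd G \<subseteq> nsets (fst G) 2"
    using k_tree_edges[OF step(1)] by auto
  have finW: "finite W" using step G by (auto simp: attach_def finite_subset)
  have C: "finite C" "card C = k" using step by (auto simp: k_clique_def)
  \<comment> \<open>the edges that were already there before \<open>v\<close> came\<close>
  let ?S = "{e \<in> snd G. e \<subseteq> W - {v}}"
  have finS: "finite ?S" using finW by (auto intro: finite_subset[of _ "Pow W"])
  have split: "{e \<in> snd (attach v C G). e \<subseteq> W} \<subseteq> ?S \<union> (if v \<in> W then (\<lambda>x. {v, x}) ` C else {})"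
    using G step(2) by (auto simp: attach_def nsets_def)
  consider (small) "v \<in> W" "card W = k" | (new) "v \<in> W" "k < card W" | (old) "v \<notin> W"
    using step(6) by linarith
  then show ?case
  proof cases
    case small
    have "{e \<in> snd (attach v C G). e \<subseteq> W} \<subseteq> nsets W 2"
    proof
      fix e assume "e \<in> {e \<in> snd (attach v C G). e \<subseteq> W}"
      moreover from this have "e \<in> nsets (fst (attach v C G)) 2"
        using k_tree_edges[OF k_tree.step[OF step(1-3)]] by blast
      ultimately show "e \<in> nsets W 2" by (simp add: nsets_def)
    qed
    then have "card {e \<in> snd (attach v C G). e \<subseteq> W} \<le> card (nsets W 2)"
      by (rule card_mono[OF finite_imp_finite_nsets[OF finW]])
    then have few: "card {e \<in> snd (attach v C G). e \<subseteq> W} \<le> k choose 2"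
      by (simp only: card_nsets small)
    have tight: "2 * (k choose 2) + k * (k + 1) = 2 * k * k"
      unfolding two_times_choose_two by (cases k) (auto simp: algebra_simps)
    have "2 * x + k * (k + 1) \<le> 2 * k * k" if "x \<le> k choose 2" for x
      using that tight by linarith
    from this[OF few] show ?thesis by (simp only: small)
  next
    case new
    have c: "card W = Suc (card (W - {v}))" by (rule card.remove[OF finW new(1)])
    with new(2) have kW: "k \<le> card (W - {v})" by linarith
    have "card {e \<in> snd (attach v C G). e \<subseteq> W} \<le> card (?S \<union> (\<lambda>x. {v, x}) ` C)"
      using split new finS C by (intro card_mono) auto
    also have "\<dots> \<le> card ?S + card ((\<lambda>x. {v, x}) ` C)" by (rule card_Un_le)
    also have "\<dots> \<le> card ?S + k"
      using card_image_le[OF C(1), of "\<lambda>x. {v, x}"] C(2) by simp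
    finally have "card {e \<in> snd (attach v C G). e \<subseteq> W} \<le> card ?S + k" .
    moreover have "2 * card ?S + k * (k + 1) \<le> 2 * k * card (W - {v})"
      using step.IH[OF _ kW] step.prems by (auto simp: attach_def)
    ultimately show ?thesis unfolding c mult_Suc_right by linarith
  next
    case old
    have "card {e \<in> snd (attach v C G). e \<subseteq> W} \<le> card ?S"
      using split old finS by (intro card_mono) auto
    moreover have "2 * card ?S + k * (k + 1) \<le> 2 * k * card W"
      using step.IH[of W] step.prems old by (auto simp: attach_def)
    ultimately show ?thesis by linarith
  qed
qed

lemma linear_k_tree_complete: "card V = k + 1 \<Longrightarrow> linear_k_tree k (complete_graph V)"
  unfolding linear_k_tree_def
  by (metis linear_k_tree_last.start card.empty add_is_0 one_neq_zero ex_in_conv)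

text \<open>A graph with an edge is contained in the complete graph on its vertices, a linear
  \<open>(card V - 1)\<close>-tree, so its width is attained and smaller than \<open>card V\<close>. The edge bound
  for \<open>k\<close>-trees then applies; its linear term \<open>k\<close> is of lower order and is dropped.\<close>

lemma edges_le_width:
  assumes T: "\<And>k H. T k H \<Longrightarrow> k_tree k H" "\<And>k H. linear_k_tree k H \<Longrightarrow> T k H"
    and E: "E \<subseteq> nsets V 2" "finite V"
  defines "k \<equiv> width T (V, E)"
  shows "2 * card E + k ^ 2 \<le> 2 * k * card V"
proof (cases "E = {}")
  case True
  then show ?thesis by (simp add: k_def width_def)
next
  case False
  let ?P = "\<lambda>k. 0 < k \<and> (\<exists>H. T k H \<and> subgraph (V, E) H)"
  have k: "k = Least ?P" using False by (simp add: k_def width_def)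
  obtain e where "e \<in> nsets V 2" using False E by blast
  then have "2 \<le> card V" using E(2) card_mono[of V e] by (auto simp: nsets_def)
  then have "T (card V - 1) (complete_graph V)"
    by (intro T linear_k_tree_complete) auto
  moreover have "subgraph (V, E) (complete_graph V)"
    using E by (simp add: subgraph_def complete_graph_def)
  moreover have "0 < card V - 1" using \<open>2 \<le> card V\<close> by simp
  ultimately have P: "?P (card V - 1)" by blast
  have "?P k" unfolding k by (rule LeastI[of ?P, OF P])
  then obtain H where H: "k_tree k H" "V \<subseteq> fst H" "E \<subseteq> snd H"
    using T(1) unfolding subgraph_def fst_conv snd_conv by blast
  have "k \<le> card V" using Least_le[of ?P, OF P] k by linarith
  then have "2 * card {e \<in> snd H. e \<subseteq> V} + k * (k + 1) \<le> 2 * k * card V"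
    using k_tree_edge_bound[OF H(1,2)] by blast
  moreover have "card E \<le> card {e \<in> snd H. e \<subseteq> V}"
    using H E by (intro card_mono) (auto simp: nsets_def intro: finite_subset[of _ "Pow V"])
  ultimately show ?thesis by (simp add: power2_eq_square algebra_simps)
qed

text \<open>Counting the edges of the complete graph part by part, followed by the inequality between the
  square of a sum and the sum of squares.\<close>

lemma decomposition_sum_lower:
  assumes T: "\<And>k H. T k H \<Longrightarrow> k_tree k H" "\<And>k H. linear_k_tree k H \<Longrightarrow> T k H"
    and dec: "decomposition r n E" and r: "r \<ge> 1"
  defines "s \<equiv> real (\<Sum>i=1..r. width T ({1..n}, E i))"
  shows "real r * n - s \<le> sqrt (real r ^ 2 - real r) * n + sqrt (real r * n)"
proof -
  define k where "k i = real (width T ({1..n}, E i))" for i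
  have s: "s = (\<Sum>i=1..r. k i)" by (simp add: s_def k_def)
  have sub: "E i \<subseteq> nsets {1..n} 2" if "i \<in> {1..r}" for i
    using dec that by (auto simp: decomposition_def)
  have fin: "finite (E i)" if "i \<in> {1..r}" for i
    using sub[OF that] finite_imp_finite_nsets[of "{1..n}"] finite_subset by blast
  have "(\<Union>i\<in>{1..r}. E i) = nsets {1..n} 2"
    using dec by (simp add: decomposition_def)
  then have "n choose 2 = card (\<Union>i\<in>{1..r}. E i)"
    by (simp only: card_nsets card_atLeastAtMost) simp
  also have "\<dots> = (\<Sum>i=1..r. card (E i))"
  proof (rule card_UN_disjoint')
    show "disjoint_family_on E {1..r}" using dec by (simp add: decomposition_def)
  qed (use fin in auto)
  finally have count: "n choose 2 = (\<Sum>i=1..r. card (E i))" .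
  have "real n ^ 2 - n = real (n * (n - 1))"
    by (cases n) (auto simp: power2_eq_square algebra_simps)
  also have "\<dots> = real (2 * (\<Sum>i=1..r. card (E i)))"
    by (simp only: two_times_choose_two flip: count)
  also have "\<dots> = (\<Sum>i=1..r. 2 * real (card (E i)))"
    by (simp add: sum_distrib_left)
  also have "\<dots> \<le> (\<Sum>i=1..r. 2 * n * k i - k i ^ 2)"
  proof (rule sum_mono)
    fix i assume "i \<in> {1..r}"
    then have "2 * card (E i) + (width T ({1..n}, E i)) ^ 2 \<le> 2 * width T ({1..n}, E i) * card {1..n}"
      by (intro edges_le_width sub) (erule T | simp)+
    then have "2 * card (E i) + (width T ({1..n}, E i)) ^ 2 \<le> 2 * width T ({1..n}, E i) * n"
      by simp
    then have "real (2 * card (E i) + (width T ({1..n}, E i)) ^ 2) \<le> real (2 * width T ({1..n}, E i) * n)"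
      by (rule of_nat_mono)
    then show "2 * real (card (E i)) \<le> 2 * n * k i - k i ^ 2"
      by (simp add: k_def algebra_simps)
  qed
  also have "\<dots> = 2 * n * s - (\<Sum>i=1..r. k i ^ 2)"
    by (simp add: s sum_subtractf sum_distrib_left)
  finally have 1: "real n ^ 2 - n \<le> 2 * n * s - (\<Sum>i=1..r. k i ^ 2)" .
  have 2: "s ^ 2 \<le> r * (\<Sum>i=1..r. k i ^ 2)"
    using sum_squared_le_sum_of_squares[of k "{1..r}"] by (simp add: s mult.commute)
  have "(real r * n - s) ^ 2 \<le> (real r ^ 2 - r) * n ^ 2 + r * n"
    using mult_left_mono[OF 1, of "real r"] 2 by (simp add: power2_eq_square algebra_simps)
  then have "real r * n - s \<le> sqrt ((real r ^ 2 - r) * n ^ 2 + r * n)"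
    by (rule real_le_rsqrt)
  also have "\<dots> \<le> sqrt ((real r ^ 2 - r) * n ^ 2) + sqrt (r * n)"
    using r by (intro sqrt_add_le_add_sqrt) (auto simp: power2_eq_square)
  also have "\<dots> = sqrt (real r ^ 2 - real r) * n + sqrt (real r * n)"
    by (simp add: real_sqrt_mult)
  finally show ?thesis .
qed

section \<open>Four blocks: the upper bound\<close>

text \<open>The state of a growing linear \<open>k\<close>-tree \<open>G\<close>: its last vertex lies in the maximal clique \<open>Q\<close>, so
  the next vertex may be joined to any facet of \<open>Q\<close> that retains this vertex. In terms of path
  decompositions, \<open>Q\<close> is the current bag.\<close>

definition front :: "nat \<Rightarrow> graph \<Rightarrow> nat set \<Rightarrow> bool" where
  "front k G Q \<longleftrightarrow> k_clique (k + 1) G Q \<and> (\<exists>u\<in>Q. linear_k_tree_last k G u)"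

text \<open>Some vertex of \<open>Q\<close> must leave when \<open>v\<close> enters. The set \<open>A\<close> to be kept and the last vertex
  together occupy at most \<open>k\<close> of the \<open>k + 1\<close> places, so a vertex outside both can be dropped.\<close>

lemma front_add:
  assumes "front k G Q" "v \<notin> fst G" "A \<subseteq> Q" "card A < k"
  obtains G' Q' where "front k G' Q'" "fst G' = insert v (fst G)" "snd G \<subseteq> snd G'"
    "insert v A \<subseteq> Q'"
proof -
  obtain u where u: "u \<in> Q" "linear_k_tree_last k G u" and Q: "k_clique (k + 1) G Q"
    using assms by (auto simp: front_def)
  have finQ: "finite Q" "card Q = k + 1" "Q \<subseteq> fst G" using Q by (auto simp: k_clique_def)
  have "card (insert u A) \<le> k"
    using assms(4) by (simp add: card_insert_if finite_subset[OF assms(3) finQ(1)])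
  then have "\<not> Q \<subseteq> insert u A"
    using finQ card_mono[of "insert u A" Q] finite_subset[OF assms(3) finQ(1)] by auto
  then obtain x where x: "x \<in> Q" "x \<noteq> u" "x \<notin> A" by blast
  let ?F = "Q - {x}" and ?G = "attach v (Q - {x}) G"
  have "facet k Q ?F" using finQ x by (auto simp: facet_def)
  then have lin: "linear_k_tree_last k ?G v"
    using linear_k_tree_last.step[OF u(2) assms(2) Q, of ?F] u x by blast
  have "k_clique (k + 1) ?G (insert v ?F)"
    using k_clique_attach[OF k_clique_facet[OF Q \<open>facet k Q ?F\<close>]] assms(2) finQ by blast
  then have "front k ?G (insert v ?F)" using lin by (auto simp: front_def)
  then show ?thesis using that[of ?G "insert v ?F"] x assms(3) by (auto simp: attach_def)
qed

lemma front_edge: "front k G Q \<Longrightarrow> x \<in> Q \<Longrightarrow> y \<in> Q \<Longrightarrow> x \<noteq> y \<Longrightarrow> {x, y} \<in> snd G"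
  unfolding front_def k_clique_def using nsets_two_iff by blast

text \<open>Bringing the vertices of \<open>A\<close> in one after the other pushes out the old clique.\<close>

lemma front_shift:
  assumes "front k G Q" "finite A" "A \<inter> fst G = {}" "card A \<le> k"
  shows "\<exists>G' Q'. front k G' Q' \<and> fst G' = fst G \<union> A \<and> snd G \<subseteq> snd G' \<and> A \<subseteq> Q'"
  using assms(2-)
proof (induction A rule: finite_induct)
  case empty
  then show ?case using assms(1) by (intro exI[of _ G] exI[of _ Q]) auto
next
  case (insert a A)
  then obtain G' Q' where G': "front k G' Q'" "fst G' = fst G \<union> A" "snd G \<subseteq> snd G'" "A \<subseteq> Q'"
    by auto
  have "a \<notin> fst G'" "card A < k" using insert G'(2) by auto
  from front_add[OF G'(1) this(1) G'(4) this(2)]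
  obtain G'' Q'' where "front k G'' Q''" "fst G'' = Set.insert a (fst G')"
    "snd G' \<subseteq> snd G''" "Set.insert a A \<subseteq> Q''"
    by blast
  with G' show ?case by (intro exI[of _ G''] exI[of _ Q'']) auto
qed

text \<open>While the core \<open>A\<close> stays in the current clique, every vertex of \<open>B\<close> meets all of \<open>A\<close> there.\<close>

lemma front_sweep:
  assumes "front k G Q" "A \<subseteq> Q" "card A < k" "finite B" "B \<inter> fst G = {}"
  shows "\<exists>G' Q'. front k G' Q' \<and> fst G' = fst G \<union> B \<and> snd G \<subseteq> snd G' \<and> A \<subseteq> Q' \<and>
    (\<forall>a\<in>A. \<forall>b\<in>B. {a, b} \<in> snd G')"
  using assms(4-)
proof (induction B rule: finite_induct)
  case empty
  then show ?case using assms by (intro exI[of _ G] exI[of _ Q]) auto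
next
  case (insert b B)
  then obtain G' Q' where G': "front k G' Q'" "fst G' = fst G \<union> B" "snd G \<subseteq> snd G'" "A \<subseteq> Q'"
    "\<forall>a\<in>A. \<forall>b\<in>B. {a, b} \<in> snd G'"
    by auto
  have "b \<notin> fst G'" using insert G'(2) by auto
  from front_add[OF G'(1) this G'(4) assms(3)] obtain G'' Q'' where G'': "front k G'' Q''" "fst G'' = Set.insert b (fst G')"
    "snd G' \<subseteq> snd G''" "Set.insert b A \<subseteq> Q''"
    by blast
  have "b \<notin> A"
    using assms(1,2) insert by (auto simp: front_def k_clique_def)
  then have "{a, b} \<in> snd G''" if "a \<in> A" for a
    using front_edge[OF G''(1)] G''(4) that by blast
  with G' G'' show ?case by (intro exI[of _ G''] exI[of _ Q'']) auto
qed

lemma front_block: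
  assumes "front k G Q" "finite A" "finite B" "card A < k" "A \<inter> B = {}" "(A \<union> B) \<inter> fst G = {}"
  obtains G' Q' where "front k G' Q'" "fst G' = fst G \<union> A \<union> B" "snd G \<subseteq> snd G'"
    "\<And>a x. a \<in> A \<Longrightarrow> x \<in> A \<union> B \<Longrightarrow> a \<noteq> x \<Longrightarrow> {a, x} \<in> snd G'"
proof -
  obtain G1 Q1 where 1: "front k G1 Q1" "fst G1 = fst G \<union> A" "snd G \<subseteq> snd G1" "A \<subseteq> Q1"
    using front_shift[OF assms(1,2)] assms(4,6) by (metis Int_Un_distrib2 Un_empty less_imp_le)
  have B: "B \<inter> fst G1 = {}" using assms(5,6) 1(2) by blast
  obtain G2 Q2 where 2: "front k G2 Q2" "fst G2 = fst G1 \<union> B" "snd G1 \<subseteq> snd G2" "A \<subseteq> Q2"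
    "\<forall>a\<in>A. \<forall>b\<in>B. {a, b} \<in> snd G2"
    using front_sweep[OF 1(1,4) assms(4,3)] B by metis
  show ?thesis
  proof (rule that[OF 2(1)])
    show "fst G2 = fst G \<union> A \<union> B" using 1(2) 2(2) by simp
    show "snd G \<subseteq> snd G2" using 1(3) 2(3) by blast
    show "{a, x} \<in> snd G2" if "a \<in> A" "x \<in> A \<union> B" "a \<noteq> x" for a x
      using that 2(4,5) front_edge[OF 2(1)] by blast
  qed
qed

text \<open>The construction starts from a clique of \<open>k + 1\<close> fresh vertices, so that both blocks are
  treated alike; being contained in a larger linear \<open>k\<close>-tree costs nothing.\<close>

lemma linear_k_tree_two_blocks:
  assumes "finite A" "finite B" "finite C" "finite D" "card A < k" "card C < k"
    and "A \<inter> B = {}" "C \<inter> D = {}" "(A \<union> B) \<inter> (C \<union> D) = {}"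
  obtains H where "linear_k_tree k H" "A \<union> B \<union> C \<union> D \<subseteq> fst H"
    "\<And>a x. a \<in> A \<Longrightarrow> x \<in> A \<union> B \<Longrightarrow> a \<noteq> x \<Longrightarrow> {a, x} \<in> snd H"
    "\<And>c x. c \<in> C \<Longrightarrow> x \<in> C \<union> D \<Longrightarrow> c \<noteq> x \<Longrightarrow> {c, x} \<in> snd H"
proof -
  have "finite (A \<union> B \<union> C \<union> D)" using assms(1-4) by simp
  then have "infinite (- (A \<union> B \<union> C \<union> D))"
    by (simp only: finite_compl infinite_UNIV_nat not_False_eq_True)
  then obtain V where V: "V \<subseteq> - (A \<union> B \<union> C \<union> D)" "finite V" "card V = k + 1"
    using infinite_arbitrarily_large[of "- (A \<union> B \<union> C \<union> D)" "k + 1"] by metis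
  then obtain u where "u \<in> V" by (metis card.empty ex_in_conv Suc_eq_plus1 nat.distinct(1))
  then have 0: "front k (complete_graph V) V"
    using V linear_k_tree_last.start[of V k u]
    by (auto simp: front_def k_clique_def complete_graph_def)
  have V_disj: "(A \<union> B) \<inter> fst (complete_graph V) = {}" "(C \<union> D) \<inter> fst (complete_graph V) = {}"
    using V by (auto simp: complete_graph_def)
  obtain G1 Q1 where 1: "front k G1 Q1" "fst G1 = fst (complete_graph V) \<union> A \<union> B"
    "\<And>a x. a \<in> A \<Longrightarrow> x \<in> A \<union> B \<Longrightarrow> a \<noteq> x \<Longrightarrow> {a, x} \<in> snd G1"
    using front_block[OF 0 assms(1,2,5,7) V_disj(1)] by metis
  have "(C \<union> D) \<inter> fst G1 = {}" using 1(2) V_disj assms(9) by blast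
  then obtain G2 Q2 where 2: "front k G2 Q2" "fst G2 = fst G1 \<union> C \<union> D" "snd G1 \<subseteq> snd G2"
    "\<And>a x. a \<in> C \<Longrightarrow> x \<in> C \<union> D \<Longrightarrow> a \<noteq> x \<Longrightarrow> {a, x} \<in> snd G2"
    using front_block[OF 1(1) assms(3,4,6,8)] by metis
  show ?thesis
  proof (rule that[of G2])
    show "linear_k_tree k G2" using 2 by (auto simp: front_def linear_k_tree_def)
    show "A \<union> B \<union> C \<union> D \<subseteq> fst G2" using 1 2 by blast
  qed (use 1 2 in blast)+
qed

lemma width_le:
  assumes "T k H" "0 < k" "subgraph G H"
  shows "width T G \<le> k"
proof (cases "snd G = {}")
  case True
  then show ?thesis by (simp add: width_def)
next
  case False
  have "(LEAST k. 0 < k \<and> (\<exists>H. T k H \<and> subgraph G H)) \<le> k"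
    using assms by (intro Least_le) blast
  then show ?thesis using False by (simp add: width_def)
qed

text \<open>Three graphs with two core blocks each: \<open>0\<close> joined to \<open>1\<close> and \<open>2\<close> joined to \<open>3\<close>; \<open>1\<close> joined to
  \<open>3\<close> and \<open>0\<close> joined to \<open>2\<close>; \<open>3\<close> joined to \<open>0\<close> and \<open>1\<close> joined to \<open>2\<close> (cores first). They overlap
  inside the blocks that are cores twice, so each edge goes to the first graph that contains it. The
  remaining \<open>r - 3\<close> parts are empty and have width \<open>0\<close>.\<close>

lemma decomposition_sum_upper:
  assumes T: "\<And>k H. linear_k_tree k H \<Longrightarrow> T k H" and r: "r \<ge> 3"
  shows "\<exists>E. decomposition r n E \<and> (\<Sum>i=1..r. width T ({1..n}, E i)) \<le> 3 * (n div 4 + 2)"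
proof -
  define m where "m = n div 4 + 1"
  \<comment> \<open>The blocks are consecutive intervals of length \<open>m\<close>, the later ones possibly cut short or empty.\<close>
  define P where "P j = {x \<in> {1..n}. (x - 1) div m = j}" for j
  have fin: "finite (P j)" for j by (simp add: P_def)
  have "P j \<subseteq> {j * m + 1 ..< j * m + m + 1}" for j
  proof
    fix x assume "x \<in> P j"
    then have x: "1 \<le> x" "(x - 1) div m = j" by (auto simp: P_def)
    have "m > 0" by (simp add: m_def)
    then have "(x - 1) mod m < m" by simp
    moreover have "x - 1 = j * m + (x - 1) mod m" using x(2) by (metis div_mult_mod_eq)
    ultimately have "j * m \<le> x - 1" "x - 1 < j * m + m" by linarith+
    then show "x \<in> {j * m + 1 ..< j * m + m + 1}" using x(1) by auto
  qed
  then have card: "card (P j) < m + 1" for j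
    using card_mono[of "{j * m + 1 ..< j * m + m + 1}" "P j"] by (simp add: less_Suc_eq_le)
  have disj: "P i \<inter> P j = {}" if "i \<noteq> j" for i j using that by (auto simp: P_def)
  have cover: "{1..n} = P 0 \<union> P 1 \<union> P 2 \<union> P 3"
  proof -
    have "(x - 1) div m \<in> {0, 1, 2, 3}" if "x \<in> {1..n}" for x
    proof -
      have "x - 1 < 4 * m" using that by (auto simp: m_def)
      then have "(x - 1) div m < 4" by (simp add: less_mult_imp_div_less)
      then show ?thesis by auto
    qed
    then show ?thesis by (fastforce simp: P_def)
  qed
  have block: "\<exists>H. linear_k_tree (m + 1) H \<and> {1..n} \<subseteq> fst H \<and>
      (\<forall>x\<in>P a. \<forall>y\<in>P a \<union> P b. x \<noteq> y \<longrightarrow> {x, y} \<in> snd H) \<and>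
      (\<forall>x\<in>P c. \<forall>y\<in>P c \<union> P d. x \<noteq> y \<longrightarrow> {x, y} \<in> snd H)"
    if "distinct [a, b, c, d]" "{0, 1, 2, 3} \<subseteq> {a, b, c, d}" for a b c d
  proof -
    have "P a \<inter> P b = {}" "P c \<inter> P d = {}" "(P a \<union> P b) \<inter> (P c \<union> P d) = {}"
      using that(1) disj by (auto simp: Int_Un_distrib Int_Un_distrib2)
    then obtain H where H: "linear_k_tree (m + 1) H" "P a \<union> P b \<union> P c \<union> P d \<subseteq> fst H"
      "\<And>x y. x \<in> P a \<Longrightarrow> y \<in> P a \<union> P b \<Longrightarrow> x \<noteq> y \<Longrightarrow> {x, y} \<in> snd H"
      "\<And>x y. x \<in> P c \<Longrightarrow> y \<in> P c \<union> P d \<Longrightarrow> x \<noteq> y \<Longrightarrow> {x, y} \<in> snd H"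
      using linear_k_tree_two_blocks[OF fin fin fin fin card card] by metis
    have "{1..n} = (\<Union>j\<in>{0, 1, 2, 3}. P j)" unfolding cover by auto
    also have "\<dots> \<subseteq> (\<Union>j\<in>{a, b, c, d}. P j)" using that(2) by (rule UN_mono) simp
    also have "\<dots> \<subseteq> fst H" using H(2) by auto
    finally have "{1..n} \<subseteq> fst H" .
    with H show ?thesis by blast
  qed
  obtain H1 where H1: "linear_k_tree (m + 1) H1" "{1..n} \<subseteq> fst H1"
    "\<And>x y. x \<in> P 0 \<Longrightarrow> y \<in> P 0 \<union> P 1 \<Longrightarrow> x \<noteq> y \<Longrightarrow> {x, y} \<in> snd H1"
    "\<And>x y. x \<in> P 2 \<Longrightarrow> y \<in> P 2 \<union> P 3 \<Longrightarrow> x \<noteq> y \<Longrightarrow> {x, y} \<in> snd H1"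
    using block[of 0 1 2 3] by fastforce
  obtain H2 where H2: "linear_k_tree (m + 1) H2" "{1..n} \<subseteq> fst H2"
    "\<And>x y. x \<in> P 1 \<Longrightarrow> y \<in> P 1 \<union> P 3 \<Longrightarrow> x \<noteq> y \<Longrightarrow> {x, y} \<in> snd H2"
    "\<And>x y. x \<in> P 0 \<Longrightarrow> y \<in> P 0 \<union> P 2 \<Longrightarrow> x \<noteq> y \<Longrightarrow> {x, y} \<in> snd H2"
    using block[of 1 3 0 2] by fastforce
  obtain H3 where H3: "linear_k_tree (m + 1) H3" "{1..n} \<subseteq> fst H3"
    "\<And>x y. x \<in> P 3 \<Longrightarrow> y \<in> P 3 \<union> P 0 \<Longrightarrow> x \<noteq> y \<Longrightarrow> {x, y} \<in> snd H3"
    "\<And>x y. x \<in> P 1 \<Longrightarrow> y \<in> P 1 \<union> P 2 \<Longrightarrow> x \<noteq> y \<Longrightarrow> {x, y} \<in> snd H3"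
    using block[of 3 0 1 2] by fastforce
  let ?K = "nsets {1..n} 2"
  have edges: "?K \<subseteq> snd H1 \<union> snd H2 \<union> snd H3"
  proof
    fix e assume "e \<in> ?K"
    then obtain x y where e: "e = {x, y}" "e = {y, x}" "x \<noteq> y" "y \<noteq> x" "x \<in> {1..n}" "y \<in> {1..n}"
      unfolding nsets_two_iff by blast
    have "x \<in> P 0 \<or> x \<in> P 1 \<or> x \<in> P 2 \<or> x \<in> P 3" "y \<in> P 0 \<or> y \<in> P 1 \<or> y \<in> P 2 \<or> y \<in> P 3"
      using e(5,6) unfolding cover by auto
    then show "e \<in> snd H1 \<union> snd H2 \<union> snd H3"
      using H1(3,4)[of x y] H1(3,4)[of y x] H2(3,4)[of x y] H2(3,4)[of y x]
        H3(3,4)[of x y] H3(3,4)[of y x] e(1-4) by (elim disjE) auto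
  qed
  define E where "E i = (if i = 1 then ?K \<inter> snd H1 else if i = 2 then ?K \<inter> snd H2 - snd H1
    else if i = 3 then ?K - snd H1 - snd H2 else {})" for i :: nat
  have split: "{1..r} = {1, 2, 3} \<union> {4..r}" using r by auto
  have "(\<Union>i\<in>{1..r}. E i) = ?K" unfolding split by (auto simp: E_def)
  moreover have "disjoint_family_on E {1..r}" by (auto simp: disjoint_family_on_def E_def)
  ultimately have "decomposition r n E" by (simp add: decomposition_def)
  moreover have "(\<Sum>i=1..r. width T ({1..n}, E i)) \<le> 3 * (m + 1)"
  proof -
    have zero: "width T ({1..n}, E i) = 0" if "i \<in> {4..r}" for i
      using that by (simp add: E_def width_def)
    have "(\<Sum>i=1..r. width T ({1..n}, E i)) = (\<Sum>i\<in>{1, 2, 3}. width T ({1..n}, E i))"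
      using r zero by (intro sum.mono_neutral_right) auto
    moreover have "width T ({1..n}, E 1) \<le> m + 1"
      using H1 by (intro width_le[of T _ H1] T) (auto simp: E_def subgraph_def)
    moreover have "width T ({1..n}, E 2) \<le> m + 1"
      using H2 by (intro width_le[of T _ H2] T) (auto simp: E_def subgraph_def)
    moreover have "width T ({1..n}, E 3) \<le> m + 1"
      using H3 edges by (intro width_le[of T _ H3] T) (auto simp: E_def subgraph_def)
    ultimately show ?thesis by simp
  qed
  ultimately show ?thesis by (auto simp: m_def)
qed

section \<open>The asymptotic bounds\<close>

text \<open>The decomposition built above also shows that the minimum ranges over a nonempty set and is
  thus attained, which the lower bound requires.\<close>

lemma min_decomposition_sum_bounds:
  assumes \<beta>: "\<beta> \<in> {tw, la, pw, ppw}" and r: "r \<ge> 3"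
  shows "real r * n - min_decomposition_sum \<beta> r n
      \<le> sqrt (real r ^ 2 - real r) * n + sqrt (real r * n)"
    and "min_decomposition_sum \<beta> r n \<le> 3 * (n div 4 + 2)"
proof -
  obtain T where T: "\<beta> = width T" "\<And>k H. T k H \<Longrightarrow> k_tree k H" "\<And>k H. linear_k_tree k H \<Longrightarrow> T k H"
    using width_class_between[OF \<beta>] by blast
  let ?P = "\<lambda>s. \<exists>E. decomposition r n E \<and> s = (\<Sum>i=1..r. \<beta> ({1..n}, E i))"
  obtain E where E: "decomposition r n E" "(\<Sum>i=1..r. \<beta> ({1..n}, E i)) \<le> 3 * (n div 4 + 2)"
    using decomposition_sum_upper[of T r n, OF T(3) r] T(1) by auto
  have P: "?P (\<Sum>i=1..r. \<beta> ({1..n}, E i))" using E by blast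
  show "min_decomposition_sum \<beta> r n \<le> 3 * (n div 4 + 2)"
    unfolding min_decomposition_sum_def using Least_le[of ?P, OF P] E(2) by linarith
  obtain E' where "decomposition r n E'"
    "min_decomposition_sum \<beta> r n = (\<Sum>i=1..r. \<beta> ({1..n}, E' i))"
    unfolding min_decomposition_sum_def using LeastI[of ?P, OF P] by blast
  then show "real r * n - min_decomposition_sum \<beta> r n
      \<le> sqrt (real r ^ 2 - real r) * n + sqrt (real r * n)"
    using decomposition_sum_lower[of T r n E', OF T(2,3)] r T(1) by simp
qed

text \<open>Because \<open>r\<^sup>2 - r < (r - 1 / 2)\<^sup>2\<close>.\<close>

lemma half_less_lower_constant:
  assumes "r \<ge> (1::real)"
  shows "1 / 2 < r - sqrt (r ^ 2 - r)"
proof -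
  have "sqrt (r ^ 2 - r) < r - 1 / 2"
    using assms by (intro real_less_lsqrt) (auto simp: power2_eq_square algebra_simps)
  then show ?thesis by simp
qed

theorem theorem1p3:
  fixes \<beta> :: "graph \<Rightarrow> nat" and r :: nat
  assumes "\<beta> \<in> {tw, la, pw, ppw}" and "r \<ge> 3"
  shows "(\<lambda>n. real (min_decomposition_sum \<beta> r n)) \<in> \<Theta>(\<lambda>n. real n) \<and>
    (\<exists>\<epsilon> \<delta> :: nat \<Rightarrow> real. \<epsilon> \<in> o(\<lambda>_. 1) \<and> \<delta> \<in> o(\<lambda>_. 1) \<and>
      (\<forall>\<^sub>F n in sequentially.
        1 / 2 - \<epsilon> n < real r - sqrt (real r ^ 2 - real r) - \<epsilon> n \<and>
        real r - sqrt (real r ^ 2 - real r) - \<epsilon> n \<le> real (min_decomposition_sum \<beta> r n) / real n \<and>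
        real (min_decomposition_sum \<beta> r n) / real n \<le> 3 / 4 + \<delta> n))"
proof -
  define s where "s n = real (min_decomposition_sum \<beta> r n)" for n
  define c where "c = real r - sqrt (real r ^ 2 - real r)"
  \<comment> \<open>The lower-order terms of the two bounds, divided by \<open>n\<close>.\<close>
  define \<epsilon> where "\<epsilon> n = sqrt (real r / real n)" for n :: nat
  define \<delta> where "\<delta> n = 6 / real n" for n :: nat
  have c: "1 / 2 < c" unfolding c_def using assms by (intro half_less_lower_constant) auto
  have lower: "c - \<epsilon> n \<le> s n / n" if "n > 0" for n :: nat
  proof -
    have "sqrt (real r * n) = \<epsilon> n * n"
      using that by (simp add: \<epsilon>_def real_sqrt_mult real_sqrt_divide field_simps)
    then have "(c - \<epsilon> n) * n \<le> s n"
      using min_decomposition_sum_bounds(1)[OF assms, of n]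
      by (simp add: s_def c_def algebra_simps)
    then show ?thesis using that by (simp add: field_simps)
  qed
  have upper: "s n / n \<le> 3 / 4 + \<delta> n" if "n > 0" for n :: nat
  proof -
    have "s n \<le> real (3 * (n div 4 + 2))"
      using min_decomposition_sum_bounds(2)[OF assms, of n] unfolding s_def by (rule of_nat_mono)
    moreover have "real (n div 4) \<le> n / 4" by linarith
    ultimately have "s n \<le> 3 / 4 * n + 6" by simp
    then show ?thesis using that by (simp add: \<delta>_def field_simps)
  qed
  have "(\<lambda>n. real r / real n) \<longlonglongrightarrow> 0" by (rule lim_const_over_n)
  then have \<epsilon>: "\<epsilon> \<longlonglongrightarrow> 0" unfolding \<epsilon>_def using tendsto_real_sqrt by fastforce
  have \<delta>: "\<delta> \<longlonglongrightarrow> 0" unfolding \<delta>_def by (rule lim_const_over_n)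
  have "\<forall>\<^sub>F n in sequentially. \<epsilon> n < c - 1 / 2" using c by (intro order_tendstoD(2)[OF \<epsilon>]) simp
  then have "\<forall>\<^sub>F n in sequentially. 1 / 2 * norm (real n) \<le> norm (s n)"
    using eventually_gt_at_top[of "0::nat"]
  proof eventually_elim
    case (elim n)
    then have "1 / 2 \<le> s n / n" using lower[of n] by linarith
    then show ?case using elim by (simp add: field_simps s_def)
  qed
  then have "s \<in> \<Omega>(\<lambda>n. real n)" by (intro landau_omega.bigI[of "1 / 2"]) auto
  moreover have "\<forall>\<^sub>F n in sequentially. norm (s n) \<le> 7 * norm (real n)"
    using eventually_gt_at_top[of "0::nat"]
  proof eventually_elim
    case (elim n)
    then have "6 / real n \<le> 6" by (simp add: field_simps)
    then have "s n / n \<le> 7" using upper[of n] elim unfolding \<delta>_def by linarith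
    then show ?case using elim by (simp add: field_simps s_def)
  qed
  then have "s \<in> O(\<lambda>n. real n)" by (intro landau_o.bigI[of 7]) auto
  ultimately have "s \<in> \<Theta>(\<lambda>n. real n)" by (rule bigthetaI[rotated])
  moreover have "\<forall>\<^sub>F n in sequentially. 1 / 2 - \<epsilon> n < c - \<epsilon> n \<and> c - \<epsilon> n \<le> s n / n \<and>
      s n / n \<le> 3 / 4 + \<delta> n"
    using eventually_gt_at_top[of "0::nat"] by eventually_elim (use lower upper c in auto)
  moreover have "\<epsilon> \<in> o(\<lambda>_. 1)" "\<delta> \<in> o(\<lambda>_. 1)"
    using \<epsilon> \<delta> by (auto intro: smalloI_tendsto)
  ultimately show ?thesis unfolding s_def c_def by blast
qed

end
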